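(* Let $2/3<\rho<1$. Let $\mu^{(\rho)}$ be the Bernoulli product measure on $\{0,1\}^{\mathbb Z}$ of density $\rho$, let $V^*=\{\eta: 0\in Q(\eta)\}$, and let $\mu^*$ be $\mu^{(\rho)}$ conditioned on $V^*$. For $\eta\in V^*$ index the points of $Q(\eta)$ as $(q_k)_{k\in\mathbb Z}$ in increasing order with $q_0=0$. Then the random variables $N^*_k=q_{k+1}-q_k$, $k\in\mathbb Z$, are i.i.d. under $\mu^*$, with distribution $$\mu^*\{N^*_k=3n+1\}=d_n\,\rho^{2n+1}(1-\rho)^n,\qquad n=0,1,2,\dots,$$ where $d_n=\frac1{2n+1}\binom{3n}{n}$.
   Context: For $\eta\in\{0,1\}^{\mathbb Z}$ the height profile $h:\mathbb Z\to\mathbb Z$ is defined by $h(0)=0$ and $h(k)-h(k-1)=(-1)^{\eta(k)}$ for all $k\in\mathbb Z$; $h^*(k)=h(k)+k/3$; and $Q(\eta)=\{q\in\mathbb Z: h^*(q)<\inf_{i<q}h^*(i)\}$. For $\rho>2/3$, $\mu^{(\rho)}$-almost surely $h^*(i)\to\mp\infty$ as $i\to\pm\infty$, so $Q(\eta)$ is unbounded above and below, and $\mu^{(\rho)}(V^* )>0$. Under $\mu^{(\rho)}$ each site is independently occupied ($\eta(i)=1$) with probability $\rho$. *)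

theory Defs
  imports "HOL-Probability.Probability"
begin

text \<open>A configuration is a function of type \<open>int \<Rightarrow> bool\<close>; \<open>True\<close> stands for an occupied
  site (value 1) and \<open>False\<close> for an empty one (value 0).\<close>

definition bernoulli_product :: "real \<Rightarrow> (int \<Rightarrow> bool) measure" where
  "bernoulli_product \<rho> = Pi\<^sub>M UNIV (\<lambda>_. measure_pmf (bernoulli_pmf \<rho>))"

text \<open>The closed form below is the unique solution of the defining recursion of the height
  profile; see \<open>height_unique\<close>.\<close>

definition height :: "(int \<Rightarrow> bool) \<Rightarrow> int \<Rightarrow> int" where
  "height \<eta> k =
     (if 0 \<le> k then \<Sum>i\<in>{0<..k}. (-1) ^ of_bool (\<eta> i)
      else - (\<Sum>i\<in>{k<..0}. (-1) ^ of_bool (\<eta> i)))"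

lemma height_0: "height \<eta> 0 = 0"
  by (simp add: height_def)

lemma height_step: "height \<eta> k - height \<eta> (k - 1) = (-1) ^ of_bool (\<eta> k)"
proof (cases "1 \<le> k")
  case True
  then have "{0<..k} = insert k {0<..k - 1}" by auto
  with True show ?thesis by (simp add: height_def)
next
  case False
  then have "{k - 1<..0} = insert k {k<..0}" by auto
  with False show ?thesis by (auto simp: height_def)
qed

lemma height_unique:
  fixes h :: "int \<Rightarrow> int"
  assumes "h 0 = 0" and "\<And>k. h k - h (k - 1) = (-1) ^ of_bool (\<eta> k)"
  shows "h = height \<eta>"
proof
  fix k
  show "h k = height \<eta> k"
  proof (induction k rule: int_induct[where k = 0])
    case base
    show ?case by (simp add: assms(1) height_0)
  next
    case (step1 i)
    then show ?case using assms(2)[of "i + 1"] height_step[of \<eta> "i + 1"] by simp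
  next
    case (step2 i)
    then show ?case using assms(2)[of i] height_step[of \<eta> i] by simp
  qed
qed

definition hstar :: "(int \<Rightarrow> bool) \<Rightarrow> int \<Rightarrow> real" where
  "hstar \<eta> k = of_int (height \<eta> k) + of_int k / 3"

text \<open>The infimum is taken in the extended reals, so that it is \<open>-\<infinity>\<close> when \<open>hstar \<eta>\<close> is not
  bounded below on \<open>{..<q}\<close>.\<close>

definition Qset :: "(int \<Rightarrow> bool) \<Rightarrow> int set" where
  "Qset \<eta> = {q. ereal (hstar \<eta> q) < (INF i\<in>{..<q}. ereal (hstar \<eta> i))}"

definition Vstar :: "(int \<Rightarrow> bool) set" where
  "Vstar = {\<eta>. 0 \<in> Qset \<eta>}"

definition mu_star :: "real \<Rightarrow> (int \<Rightarrow> bool) measure" where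
  "mu_star \<rho> = uniform_measure (bernoulli_product \<rho>) Vstar"

definition increasing_index :: "(int \<Rightarrow> int) \<Rightarrow> int set \<Rightarrow> bool" where
  "increasing_index q A \<longleftrightarrow> strict_mono q \<and> range q = A \<and> q 0 = 0"

lemma increasing_index_unique:
  assumes "increasing_index q A" and "increasing_index q' A"
  shows "q = q'"
proof
  have mono: "strict_mono q" "strict_mono q'" and ran: "range q = range q'"
    and zero: "q 0 = q' 0"
    using assms by (auto simp: increasing_index_def)
  have succ: "p (k + 1) \<le> p' (k + 1)"
    if H: "strict_mono p" "strict_mono p'" "range p = range p'" "p k = p' k"
    for p p' :: "int \<Rightarrow> int" and k
  proof -
    obtain j where j: "p' (k + 1) = p j" using H(3) by (metis rangeE rangeI)
    have "p k < p j" using H(2,4) j by (metis strict_monoD zless_add1_eq)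
    then have "k + 1 \<le> j" using H(1) strict_mono_less by fastforce
    then show ?thesis using H(1) j by (simp add: strict_mono_less_eq)
  qed
  have pred: "p (k - 1) \<le> p' (k - 1)"
    if H: "strict_mono p" "strict_mono p'" "range p = range p'" "p k = p' k"
    for p p' :: "int \<Rightarrow> int" and k
  proof -
    obtain j where j: "p (k - 1) = p' j" using H(3) by (metis rangeE rangeI)
    have "p (k - 1) < p k" using H(1) by (simp add: strict_mono_less)
    then have "p' j < p' k" using H(4) j by simp
    then have "j \<le> k - 1" using H(2) by (simp add: strict_mono_less)
    then show ?thesis using H(2) j by (simp add: strict_mono_less_eq)
  qed
  fix k
  show "q k = q' k"
  proof (induction k rule: int_induct[where k = 0])
    case base
    show ?case by (fact zero)
  next
    case (step1 i)
    show ?case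
      using succ[OF mono ran step1(2)] succ[OF mono(2,1) ran[symmetric] step1(2)[symmetric]]
      by simp
  next
    case (step2 i)
    show ?case
      using pred[OF mono ran step2(2)] pred[OF mono(2,1) ran[symmetric] step2(2)[symmetric]]
      by simp
  qed
qed

text \<open>An increasing indexing by all integers exists exactly when \<open>0 \<in> Qset \<eta>\<close> and \<open>Qset \<eta>\<close> is
  unbounded above and below; by \<open>increasing_index_unique\<close> it is then unique. For all other
  \<open>\<eta>\<close> (a \<open>mu_star \<rho>\<close>-null set when \<open>2/3 < \<rho> < 1\<close>), \<open>qpoint \<eta>\<close> is an unspecified
  function that does not depend on \<open>\<eta>\<close>.\<close>

definition qpoint :: "(int \<Rightarrow> bool) \<Rightarrow> int \<Rightarrow> int" where
  "qpoint \<eta> = (THE q. increasing_index q (Qset \<eta>))"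

definition Nstar :: "int \<Rightarrow> (int \<Rightarrow> bool) \<Rightarrow> int" where
  "Nstar k \<eta> = qpoint \<eta> (k + 1) - qpoint \<eta> k"

definition dcoef :: "nat \<Rightarrow> real" where
  "dcoef n = 1 / of_nat (2 * n + 1) * of_nat ((3 * n) choose n)"

end

theory Submission
  imports Defs
begin

text \<open>
  The function \<open>3/2 h\<^sup>*\<close> is an integer-valued walk that steps by \<open>-1\<close> at occupied sites and by
  \<open>+2\<close> at empty ones, and \<open>Q(\<eta>)\<close> is the set of its strict record minima. As it never skips a level
  on its way down, consecutive records lie on consecutive levels, and the gap after a record \<open>a\<close> is
  \<open>n\<close> exactly when the sites \<open>a + 1, \<dots>, a + n\<close> spell a first-passage word of descent 1. Since
  \<open>a \<in> Q(\<eta>)\<close> depends only on the sites up to \<open>a\<close>, and has a probability that does not depend on \<open>a\<close>,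
  the event that a prescribed chain of records passes through 0 has probability \<open>P(V\<^sup>*)\<close> times a
  product of first-passage probabilities, even if the chain starts to the left of 0.

  The closed form of the first-passage probabilities for descent \<open>k\<close> follows by decomposing at the
  first step, which stays within the family \<open>k / (3 u + k) \<cdot> C(3 u + k, u)\<close>. For \<open>\<rho> > 2/3\<close> the step has
  an exponential moment less than 1, so by Borel-Cantelli every level is almost surely attained by a
  record; hence some, and by stationarity every, site is a record with positive probability.
\<close>

section \<open>The walk and its records\<close>

definition walk_step :: "bool \<Rightarrow> int" where
  "walk_step b = (if b then - 1 else 2)"

text \<open>Serves twice: for the walk, and for turning prescribed gaps into positions of records.
  The sign for negative \<open>k\<close> makes \<open>psum_Suc\<close> hold across 0.\<close>

definition psum :: "(int \<Rightarrow> int) \<Rightarrow> int \<Rightarrow> int" where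
  "psum f k = (if 0 \<le> k then \<Sum>i\<in>{0<..k}. f i else - (\<Sum>i\<in>{k<..0}. f i))"

lemma psum_0 [simp]: "psum f 0 = 0"
  by (simp add: psum_def)

lemma psum_Suc: "psum f (k + 1) = psum f k + f (k + 1)"
proof (cases "0 \<le> k")
  case True
  then have "{0<..k + 1} = insert (k + 1) {0<..k}" by auto
  with True show ?thesis by (simp add: psum_def)
next
  case False
  then have "{k<..0} = insert (k + 1) {k + 1<..0}" by auto
  with False show ?thesis by (auto simp: psum_def)
qed

definition walk :: "(int \<Rightarrow> bool) \<Rightarrow> int \<Rightarrow> int" where
  "walk \<eta> = psum (\<lambda>i. walk_step (\<eta> i))"

lemma walk_0 [simp]: "walk \<eta> 0 = 0"
  by (simp add: walk_def)

lemma walk_Suc: "walk \<eta> (k + 1) = walk \<eta> k + walk_step (\<eta> (k + 1))"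
  by (simp add: walk_def psum_Suc)

lemma walk_ge: "walk \<eta> (k + 1) \<ge> walk \<eta> k - 1"
  by (simp add: walk_Suc walk_step_def)

lemma walk_diff:
  assumes "i \<le> j"
  shows "walk \<eta> j - walk \<eta> i = (\<Sum>k\<in>{i<..j}. walk_step (\<eta> k))"
  using assms
proof (induction j rule: int_ge_induct)
  case base
  then show ?case by simp
next
  case (step j)
  then have "{i<..j + 1} = insert (j + 1) {i<..j}" by auto
  with step show ?case by (simp add: walk_Suc)
qed

text \<open>Only increments are a function of the sites up to \<open>a\<close>: the walk is anchored
  at 0, so for \<open>a < 0\<close> its values also involve the sites after \<open>a\<close> up to
  0.\<close>

lemma walk_diff_cong:
  assumes "\<And>k. k \<le> a \<Longrightarrow> \<eta> k = \<eta>' k" "i \<le> a" "j \<le> a"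
  shows "walk \<eta> j - walk \<eta> i = walk \<eta>' j - walk \<eta>' i"
proof -
  have *: "walk \<eta> j - walk \<eta> i = walk \<eta>' j - walk \<eta>' i" if "i \<le> j" "j \<le> a" for i j
    using that assms(1) by (auto simp: walk_diff intro!: sum.cong)
  show ?thesis
    using *[of i j] *[of j i] assms by linarith
qed

lemma walk_shift: "walk (\<lambda>i. \<eta> (i + a)) k = walk \<eta> (k + a) - walk \<eta> a"
proof (induction k rule: int_induct[where k = 0])
  case base
  show ?case by simp
next
  case (step1 i)
  then show ?case
    using walk_Suc[of "\<lambda>i. \<eta> (i + a)" i] walk_Suc[of \<eta> "i + a"] by (simp add: algebra_simps)
next
  case (step2 i)
  then show ?case
    using walk_Suc[of "\<lambda>i. \<eta> (i + a)" "i - 1"] walk_Suc[of \<eta> "i + a - 1"]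
    by (simp add: algebra_simps)
qed

lemma height_walk: "3 * height \<eta> k + k = 2 * walk \<eta> k"
proof (induction k rule: int_induct[where k = 0])
  case base
  show ?case by (simp add: height_0)
next
  case (step1 i)
  then show ?case
    using walk_Suc[of \<eta> i] height_step[of \<eta> "i + 1"]
    by (cases "\<eta> (i + 1)") (simp_all add: walk_step_def)
next
  case (step2 i)
  then show ?case
    using walk_Suc[of \<eta> "i - 1"] height_step[of \<eta> i]
    by (cases "\<eta> i") (simp_all add: walk_step_def)
qed

lemma hstar_walk: "hstar \<eta> k = 2 / 3 * of_int (walk \<eta> k)"
proof -
  have "of_int (3 * height \<eta> k + k) = (of_int (2 * walk \<eta> k) :: real)"
    by (simp only: height_walk)
  then show ?thesis
    unfolding hstar_def by simp
qed

text \<open>The walk is integer-valued, so passing to the infimum does not lose strictness.\<close>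

lemma Qset_iff: "q \<in> Qset \<eta> \<longleftrightarrow> (\<forall>i<q. walk \<eta> q < walk \<eta> i)"
proof
  assume "q \<in> Qset \<eta>"
  then have "ereal (hstar \<eta> q) < ereal (hstar \<eta> i)" if "i < q" for i
    using that less_INF_D[of "ereal (hstar \<eta> q)" "\<lambda>i. ereal (hstar \<eta> i)" "{..<q}" i]
    unfolding Qset_def by simp
  then show "\<forall>i<q. walk \<eta> q < walk \<eta> i"
    by (simp add: hstar_walk)
next
  assume *: "\<forall>i<q. walk \<eta> q < walk \<eta> i"
  \<comment> \<open>\<open>2 / 3\<close> is one level of the walk on the scale of
    \<open>hstar\<close>, a margin uniform in \<open>i\<close>.\<close>
  have "ereal (hstar \<eta> q + 2 / 3) \<le> ereal (hstar \<eta> i)" if "i < q" for i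
  proof -
    have "walk \<eta> q + 1 \<le> walk \<eta> i"
      using * that by (simp add: add1_zle_eq)
    then have "of_int (walk \<eta> q + 1) \<le> (of_int (walk \<eta> i) :: real)"
      by (simp only: of_int_le_iff)
    then show ?thesis
      by (simp add: hstar_walk)
  qed
  then have "ereal (hstar \<eta> q + 2 / 3) \<le> (INF i\<in>{..<q}. ereal (hstar \<eta> i))"
    by (intro INF_greatest) auto
  moreover have "ereal (hstar \<eta> q) < ereal (hstar \<eta> q + 2 / 3)"
    by simp
  ultimately show "q \<in> Qset \<eta>"
    unfolding Qset_def mem_Collect_eq by (rule less_le_trans[rotated])
qed

lemma Qset_shift: "0 \<in> Qset (\<lambda>i. \<eta> (i + a)) \<longleftrightarrow> a \<in> Qset \<eta>"
proof
  assume *: "0 \<in> Qset (\<lambda>i. \<eta> (i + a))"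
  show "a \<in> Qset \<eta>"
    unfolding Qset_iff
  proof (intro allI impI)
    fix i assume "i < a"
    then show "walk \<eta> a < walk \<eta> i"
      using *[unfolded Qset_iff, rule_format, of "i - a"] by (simp add: walk_shift)
  qed
qed (simp add: Qset_iff walk_shift)

lemma Qset_cong:
  assumes "\<And>k. k \<le> a \<Longrightarrow> \<eta> k = \<eta>' k" "q \<le> a"
  shows "q \<in> Qset \<eta> \<longleftrightarrow> q \<in> Qset \<eta>'"
proof -
  have "walk \<eta> q < walk \<eta> i \<longleftrightarrow> walk \<eta>' q < walk \<eta>' i" if "i < q" for i
    using walk_diff_cong[of a \<eta> \<eta>' i q] assms that by auto
  then show ?thesis by (simp add: Qset_iff)
qed

text \<open>Each record lies strictly below its whole past, so the walk decreases along the records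
  and a record is identified by its level.\<close>

lemma Qset_walk_less:
  assumes "a \<in> Qset \<eta>" "b \<in> Qset \<eta>"
  shows "a < b \<longleftrightarrow> walk \<eta> b < walk \<eta> a"
  using assms unfolding Qset_iff by (metis less_asym less_irrefl not_less_iff_gr_or_eq)

lemma Qset_walk_inj:
  assumes "a \<in> Qset \<eta>" "b \<in> Qset \<eta>" "walk \<eta> a = walk \<eta> b"
  shows "a = b"
  using Qset_walk_less[OF assms(1,2)] Qset_walk_less[OF assms(2,1)] assms(3) by linarith

text \<open>The walk goes down by at most one per step, so it cannot jump over a level.\<close>

lemma Qset_level:
  assumes low: "\<And>i. i \<le> a \<Longrightarrow> l < walk \<eta> i" and b: "a \<le> b" "walk \<eta> b \<le> l"
  obtains c where "a < c" "c \<le> b" "c \<in> Qset \<eta>" "walk \<eta> c = l"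
proof -
  define P where "P n \<longleftrightarrow> walk \<eta> (a + int n) \<le> l" for n
  have Pb: "P (nat (b - a))"
    using b by (simp add: P_def)
  define n where "n = (LEAST n. P n)"
  have n: "P n" "n \<le> nat (b - a)"
    unfolding n_def using Pb by (auto intro: LeastI Least_le)
  have below: "\<not> P m" if "m < n" for m
    using that unfolding n_def by (rule not_less_Least)
  have "n \<noteq> 0"
    using n(1) low[of a] by (intro notI) (simp add: P_def)
  then obtain m where m: "n = Suc m"
    by (cases n) auto
  have above: "l < walk \<eta> i" if "i < a + int n" for i
  proof (cases "i \<le> a")
    case False
    with that have "\<not> P (nat (i - a))"
      by (intro below) auto
    with False show ?thesis by (simp add: P_def)
  qed (rule low)
  \<comment> \<open>One step earlier the walk was still above \<open>l\<close>, and it falls by at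
    most one.\<close>
  have "walk \<eta> (a + int n) = l"
    using n(1) above[of "a + int m"] walk_ge[of \<eta> "a + int m"] m
    by (simp add: P_def algebra_simps)
  with above n b \<open>n \<noteq> 0\<close> show thesis
    by (intro that[of "a + int n"]) (auto simp: Qset_iff)
qed

section \<open>Records at every level and the increasing indexing\<close>

definition all_levels :: "(int \<Rightarrow> bool) \<Rightarrow> bool" where
  "all_levels \<eta> \<longleftrightarrow> (\<forall>l. \<exists>i. i \<in> Qset \<eta> \<and> walk \<eta> i = l)"

lemma all_levelsI:
  assumes "\<And>c. \<exists>a. \<forall>i\<le>a. c < walk \<eta> i" "\<And>c. \<exists>i. walk \<eta> i \<le> c"
  shows "all_levels \<eta>"
  unfolding all_levels_def
proof
  fix l
  obtain a where a: "\<And>i. i \<le> a \<Longrightarrow> l < walk \<eta> i"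
    using assms(1) by blast
  obtain b where b: "walk \<eta> b \<le> l"
    using assms(2) by blast
  have "a \<le> b"
    using a[of b] b by linarith
  then show "\<exists>i. i \<in> Qset \<eta> \<and> walk \<eta> i = l"
    using Qset_level[of a l \<eta> b] a b by blast
qed

text \<open>By \<open>Qset_level\<close> the level just below a record is attained by a record no
  later than the next indexed point, hence at that point. So each index step lowers the level by
  one, starting from level 0 at \<open>q 0 = 0\<close>.\<close>

lemma increasing_index_walk:
  assumes "increasing_index q (Qset \<eta>)"
  shows "walk \<eta> (q k) = - k"
proof -
  have mono: "strict_mono q" and ran: "range q = Qset \<eta>" and q0: "q 0 = 0"
    using assms by (auto simp: increasing_index_def)
  have Q: "q i \<in> Qset \<eta>" for i
    using ran by auto
  have step: "walk \<eta> (q (i + 1)) = walk \<eta> (q i) - 1" for i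
  proof -
    have lt: "q i < q (i + 1)"
      using mono by (simp add: strict_mono_less)
    then have *: "walk \<eta> (q (i + 1)) \<le> walk \<eta> (q i) - 1"
      using Qset_walk_less[OF Q Q] by force
    have "walk \<eta> (q i) - 1 < walk \<eta> j" if "j \<le> q i" for j
      using Q[of i, unfolded Qset_iff, rule_format, of j] that by (cases "j = q i") auto
    then obtain c where c: "q i < c" "c \<le> q (i + 1)" "c \<in> Qset \<eta>" "walk \<eta> c = walk \<eta> (q i) - 1"
      using Qset_level[OF _ less_imp_le[OF lt] *] by metis
    obtain j where j: "c = q j"
      using c(3) ran by auto
    have "i < j" "j \<le> i + 1"
      using c(1,2) mono unfolding j by (simp_all add: strict_mono_less strict_mono_less_eq)
    then have "j = i + 1"
      by simp
    with c j show ?thesis by simp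
  qed
  show ?thesis
  proof (induction k rule: int_induct[where k = 0])
    case base
    show ?case by (simp add: q0)
  next
    case (step1 i)
    then show ?case using step[of i] by simp
  next
    case (step2 i)
    then show ?case using step[of "i - 1"] by simp
  qed
qed

lemma ex_increasing_index_iff:
  "(\<exists>q. increasing_index q (Qset \<eta>)) \<longleftrightarrow> \<eta> \<in> Vstar \<and> all_levels \<eta>"
proof
  assume "\<exists>q. increasing_index q (Qset \<eta>)"
  then obtain q where q: "increasing_index q (Qset \<eta>)" by blast
  then have "range q = Qset \<eta>" "q 0 = 0"
    by (auto simp: increasing_index_def)
  moreover have "walk \<eta> (q (- l)) = l" for l
    using increasing_index_walk[OF q] by simp
  ultimately show "\<eta> \<in> Vstar \<and> all_levels \<eta>"
    unfolding Vstar_def all_levels_def by (metis mem_Collect_eq rangeI)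
next
  assume *: "\<eta> \<in> Vstar \<and> all_levels \<eta>"
  then obtain p where p: "\<And>l. p l \<in> Qset \<eta>" "\<And>l. walk \<eta> (p l) = l"
    unfolding all_levels_def by metis
  \<comment> \<open>Records are listed by level; the sign is reversed because later records are
    lower.\<close>
  have "increasing_index (\<lambda>k. p (- k)) (Qset \<eta>)"
    unfolding increasing_index_def
  proof (intro conjI)
    show "strict_mono (\<lambda>k. p (- k))"
      using p Qset_walk_less[OF p(1) p(1)] by (simp add: strict_mono_def)
    show "range (\<lambda>k. p (- k)) = Qset \<eta>"
    proof (intro set_eqI iffI)
      fix i assume i: "i \<in> Qset \<eta>"
      then have "i = p (- (- walk \<eta> i))"
        by (intro Qset_walk_inj[OF _ p(1)]) (simp_all add: p)
      then show "i \<in> range (\<lambda>k. p (- k))"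
        by blast
    qed (use p in auto)
    show "p (- 0) = 0"
      using * by (intro Qset_walk_inj[OF p(1)]) (simp_all add: p Vstar_def)
  qed
  then show "\<exists>q. increasing_index q (Qset \<eta>)" by blast
qed

text \<open>Removes the definite description: events about the indexing become events about records
  and levels.\<close>

lemma qpoint_eq_iff:
  assumes "\<eta> \<in> Vstar" "all_levels \<eta>"
  shows "qpoint \<eta> k = j \<longleftrightarrow> j \<in> Qset \<eta> \<and> walk \<eta> j = - k"
proof -
  obtain q where q: "increasing_index q (Qset \<eta>)"
    using assms ex_increasing_index_iff by blast
  then have "qpoint \<eta> = q"
    unfolding qpoint_def using increasing_index_unique by blast
  moreover have "q k \<in> Qset \<eta>" "walk \<eta> (q k) = - k"
    using q increasing_index_walk[OF q] by (auto simp: increasing_index_def)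
  ultimately show ?thesis
    using Qset_walk_inj by metis
qed

lemma Nstar_eq_iff:
  assumes "\<eta> \<in> Vstar" "all_levels \<eta>"
  shows "Nstar k \<eta> = n \<longleftrightarrow> (\<exists>j. j \<in> Qset \<eta> \<and> walk \<eta> j = - k \<and>
           j + n \<in> Qset \<eta> \<and> walk \<eta> (j + n) = - (k + 1))"
  using qpoint_eq_iff[OF assms, of k] qpoint_eq_iff[OF assms, of "k + 1"]
  unfolding Nstar_def by (metis add.commute diff_add_cancel add_diff_cancel_left')

lemma Nstar_pos:
  assumes "\<eta> \<in> Vstar" "all_levels \<eta>"
  shows "0 < Nstar k \<eta>"
  using Nstar_eq_iff[OF assms, of k "Nstar k \<eta>"] Qset_walk_less by fastforce

text \<open>\<open>first_passage k w\<close>: the steps of \<open>w\<close> bring the walk down by \<open>k\<close> for the first time at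
  the last letter of \<open>w\<close>. A step up by 2 turns the remaining descent \<open>Suc k\<close> into \<open>k + 3\<close>.\<close>

fun first_passage :: "nat \<Rightarrow> bool list \<Rightarrow> bool" where
  "first_passage 0 w \<longleftrightarrow> w = []"
| "first_passage (Suc k) [] \<longleftrightarrow> False"
| "first_passage (Suc k) (b # w) \<longleftrightarrow> first_passage (if b then k else k + 3) w"

text \<open>Starts at \<open>a + 1\<close> because a record at \<open>a\<close> already depends on
  the site \<open>a\<close>.\<close>

definition word :: "(int \<Rightarrow> bool) \<Rightarrow> int \<Rightarrow> nat \<Rightarrow> bool list" where
  "word \<eta> a n = map (\<lambda>i. \<eta> (a + 1 + int i)) [0..<n]"

lemma length_word [simp]: "length (word \<eta> a n) = n"
  by (simp add: word_def)

lemma word_0 [simp]: "word \<eta> a 0 = []"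
  by (simp add: word_def)

lemma word_Suc: "word \<eta> a (Suc n) = \<eta> (a + 1) # word \<eta> (a + 1) n"
  unfolding word_def by (simp add: upt_conv_Cons map_Suc_upt[symmetric] algebra_simps del: upt_Suc)

lemma word_snoc: "word \<eta> a (Suc n) = word \<eta> a n @ [\<eta> (a + 1 + int n)]"
  by (simp add: word_def)

lemma walk_word: "walk \<eta> (a + int n) - walk \<eta> a = (\<Sum>b\<leftarrow>word \<eta> a n. walk_step b)"
proof (induction n)
  case (Suc n)
  then show ?case
    using walk_Suc[of \<eta> "a + int n"] by (simp add: word_snoc algebra_simps)
qed simp

lemma first_passage_word:
  "first_passage k (word \<eta> a n) \<longleftrightarrow>
     walk \<eta> (a + int n) = walk \<eta> a - int k \<and> (\<forall>i<n. walk \<eta> a - int k < walk \<eta> (a + int i))"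
proof (induction n arbitrary: a k)
  case 0
  show ?case by (cases k) auto
next
  case (Suc n)
  show ?case
  proof (cases k)
    case 0
    then show ?thesis by (auto simp: word_Suc)
  next
    case (Suc k')
    have *: "(\<forall>i<Suc n. P i) \<longleftrightarrow> P 0 \<and> (\<forall>i<n. P (Suc i))" for P
      using less_Suc_eq_0_disj by auto
    show ?thesis
      unfolding * Suc word_Suc
      using Suc.IH[of _ "a + 1"] walk_Suc[of \<eta> a]
      by (cases "\<eta> (a + 1)") (simp_all add: walk_step_def algebra_simps)
  qed
qed

text \<open>A record lies below its whole past, so whether a later site is a record one level down
  depends only on the letters read since \<open>a\<close>.\<close>

lemma first_passage_Qset:
  assumes "a \<in> Qset \<eta>"
  shows "first_passage 1 (word \<eta> a n) \<longleftrightarrow> a + int n \<in> Qset \<eta> \<and> walk \<eta> (a + int n) = walk \<eta> a - 1"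
    (is "?L \<longleftrightarrow> ?R")
proof
  assume ?L
  then have *: "walk \<eta> (a + int n) = walk \<eta> a - 1" "\<And>i. i < n \<Longrightarrow> walk \<eta> a - 1 < walk \<eta> (a + int i)"
    by (auto simp: first_passage_word)
  have "walk \<eta> a - 1 < walk \<eta> i" if "i < a + int n" for i
  proof (cases "i < a")
    case True
    then show ?thesis using assms by (force simp: Qset_iff)
  next
    case False
    then show ?thesis using *(2)[of "nat (i - a)"] that by simp
  qed
  with * show ?R by (simp add: Qset_iff)
next
  assume ?R
  then show ?L by (auto simp: first_passage_word Qset_iff)
qed

section \<open>First-passage probabilities\<close>

definition fp_words :: "nat \<Rightarrow> nat \<Rightarrow> bool list set" where
  "fp_words k n = {w. length w = n \<and> first_passage k w}"

definition weight :: "real \<Rightarrow> bool list \<Rightarrow> real" where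
  "weight \<rho> w = (\<Prod>b\<leftarrow>w. if b then \<rho> else 1 - \<rho>)"

lemma weight_simps [simp]:
  "weight \<rho> [] = 1" "weight \<rho> (b # w) = (if b then \<rho> else 1 - \<rho>) * weight \<rho> w"
  "weight \<rho> (v @ w) = weight \<rho> v * weight \<rho> w"
  by (simp_all add: weight_def)

lemma finite_words [simp]: "finite {w :: bool list. length w = n}"
  using finite_lists_length_eq[of "UNIV :: bool set" n] by simp

lemma finite_fp_words [simp]: "finite (fp_words k n)"
  by (rule finite_subset[OF _ finite_words[of n]]) (auto simp: fp_words_def)

lemma fp_words_simps:
  "fp_words 0 0 = {[]}" "fp_words 0 (Suc n) = {}" "fp_words (Suc k) 0 = {}"
  "fp_words (Suc k) (Suc n) = (#) True ` fp_words k n \<union> (#) False ` fp_words (k + 3) n"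
  by (auto simp: fp_words_def length_Suc_conv image_iff split: if_splits)

definition fp_prob :: "real \<Rightarrow> nat \<Rightarrow> nat \<Rightarrow> real" where
  "fp_prob \<rho> k n = (\<Sum>w\<in>fp_words k n. weight \<rho> w)"

lemma fp_prob_Suc_Suc:
  "fp_prob \<rho> (Suc k) (Suc n) = \<rho> * fp_prob \<rho> k n + (1 - \<rho>) * fp_prob \<rho> (k + 3) n"
  unfolding fp_prob_def fp_words_simps
  by (subst sum.union_disjoint) (auto simp: sum.reindex sum_distrib_left)

text \<open>The walk falls by at most one per step, so a descent of \<open>k\<close> takes at least
  \<open>k\<close> steps.\<close>

lemma fp_prob_less: "n < k \<Longrightarrow> fp_prob \<rho> k n = 0"
proof (induction n arbitrary: k)
  case 0
  then show ?case by (cases k) (simp_all add: fp_prob_def fp_words_simps)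
next
  case (Suc n)
  then show ?case by (cases k) (simp_all add: fp_prob_Suc_Suc)
qed

text \<open>The first-step recursion for the coefficients in \<open>fp_prob_eq\<close>: a fall
  leaves descent \<open>k\<close> with \<open>u\<close> rises to come, a rise leaves descent
  \<open>k + 3\<close> with \<open>u - 1\<close>, and both have \<open>n\<close> steps left. All
  binomials are rational multiples of \<open>n choose u\<close>.\<close>

lemma choose_first_step:
  assumes "0 < u" "n = 3 * u + k"
  shows "real (k + 1) / real (n + 1) * real ((n + 1) choose u) =
    real k / real n * real (n choose u) + real (k + 3) / real n * real (n choose (u - 1))"
proof -
  obtain v where u: "u = Suc v" using assms(1) by (cases u) auto
  have 1: "real (n + 1 - u) * real ((n + 1) choose u) = real (n + 1) * real (n choose u)"
    using binomial_absorb_comp[of "n + 1" u] by (simp only: of_nat_mult[symmetric]) simp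
  have 2: "real u * real (n choose u) = real (n + 1 - u) * real (n choose (u - 1))"
    using binomial_absorption[of v n] binomial_absorb_comp[of n v] 
    unfolding u by (simp only: of_nat_mult[symmetric]) simp
  have pos: "real (n + 1 - u) > 0" "real n > 0"
    using assms by auto
  have e: "real (n + 1 - u) = 2 * real u + real k + 1" "real n = 3 * real u + real k"
    using assms by (auto simp: of_nat_diff)
  have 3: "real ((n + 1) choose u) = real (n + 1) * real (n choose u) / real (n + 1 - u)"
    using 1 pos by (simp add: field_simps)
  have 4: "real (n choose (u - 1)) = real u * real (n choose u) / real (n + 1 - u)"
    using 2 pos by (simp add: field_simps)
  \<comment> \<open>The identity over the reals, with \<open>d\<close> for \<open>n + 1 - u\<close>,
    \<open>m\<close> for \<open>n + 1\<close> and \<open>c\<close> for \<open>n choose u\<close>;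
    its last premise is supplied by \<open>key\<close>.\<close>
  have *: "(k + 1) / m * (m * c / d) = k / n * c + (k + 3) / n * (u * c / d)"
    if "d \<noteq> 0" "n \<noteq> 0" "m \<noteq> 0" "k * d + (k + 3) * u = (k + 1) * n" for k m c d n u :: real
  proof -
    have "k / n * c + (k + 3) / n * (u * c / d) = (k * d + (k + 3) * u) * c / (n * d)"
      using that(1,2) by (simp add: field_simps)
    then show ?thesis
      using that by simp
  qed
  have key: "real k * real (n + 1 - u) + (real k + 3) * real u = (real k + 1) * real n"
    unfolding e by (simp add: algebra_simps)
  have nz: "real (n + 1 - u) \<noteq> 0" "real n \<noteq> 0" "real (n + 1) \<noteq> 0"
    using pos by linarith+
  have "real (k + 1) = real k + 1" "real (k + 3) = real k + 3"
    by simp_all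
  then show ?thesis
    unfolding 3 4 using *[OF nz key, of "real (n choose u)"] by (simp only:)
qed

text \<open>Here \<open>u\<close> counts the rises of the word, and the remaining
  \<open>2 * u + k\<close> letters are falls. Length 0 is excluded because the empty word gives 1
  for \<open>k = 0\<close>, while the quotient \<open>0 / 0\<close> is 0.\<close>

lemma fp_prob_eq:
  assumes "0 < 3 * u + k"
  shows "fp_prob \<rho> k (3 * u + k) =
    real k / real (3 * u + k) * real ((3 * u + k) choose u) * \<rho> ^ (2 * u + k) * (1 - \<rho>) ^ u"
proof -
  have "fp_prob \<rho> k n = real k / real n * real (n choose u) * \<rho> ^ (2 * u + k) * (1 - \<rho>) ^ u"
    if "n = 3 * u + k" "0 < n" for n
    using that
  proof (induction n arbitrary: u k)
    case (Suc n)
    show ?case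
    proof (cases k)
      case 0
      then show ?thesis by (simp add: fp_prob_def fp_words_simps)
    next
      case k: (Suc k')
      have n: "n = 3 * u + k'" using Suc.prems k by simp
      show ?thesis
      proof (cases u)
        case 0
        \<comment> \<open>Without rises the only word consists of falls; \<open>n = 0\<close> is
          separate because the induction hypothesis covers positive lengths only.\<close>
        have "fp_prob \<rho> k' n = \<rho> ^ k'"
          using n 0 Suc.IH[of 0 k'] by (cases "n = 0") (simp_all add: fp_prob_def fp_words_simps)
        then show ?thesis
          unfolding k fp_prob_Suc_Suc using n 0 by (simp add: fp_prob_less)
      next
        case u: (Suc v)
        have u0: "0 < u" using u by simp
        have n': "n = 3 * v + (k' + 3)" "0 < n" using n u by simp_all
        have a: "fp_prob \<rho> k' n = real k' / real n * real (n choose u) * \<rho> ^ (2 * u + k') * (1 - \<rho>) ^ u"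
          by (rule Suc.IH[OF n n'(2)])
        have b: "fp_prob \<rho> (k' + 3) n =
            real (k' + 3) / real n * real (n choose (u - 1)) * \<rho> ^ (2 * u + k) * (1 - \<rho>) ^ v"
        proof -
          have e: "2 * v + (k' + 3) = 2 * u + k" by (simp add: u k)
          show ?thesis
            using Suc.IH[OF n'] unfolding e by (simp add: u)
        qed
        have "fp_prob \<rho> k (Suc n) = (real k' / real n * real (n choose u) +
            real (k' + 3) / real n * real (n choose (u - 1))) * \<rho> ^ (2 * u + k) * (1 - \<rho>) ^ u"
          unfolding k fp_prob_Suc_Suc a b unfolding u by (simp add: distrib_left distrib_right mult.assoc mult.left_commute)
        also have "\<dots> = real k / real (Suc n) * real (Suc n choose u) * \<rho> ^ (2 * u + k) * (1 - \<rho>) ^ u"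
          unfolding k Suc_eq_plus1 choose_first_step[OF u0 n] ..
        finally show ?thesis .
      qed
    qed
  qed simp
  from this[OF refl assms] show ?thesis .
qed

text \<open>The case \<open>k = 1\<close>: by absorption its coefficient is the Fuss-Catalan number
  \<open>dcoef n\<close>.\<close>

lemma fp_prob_dcoef: "fp_prob \<rho> 1 (3 * n + 1) = dcoef n * \<rho> ^ (2 * n + 1) * (1 - \<rho>) ^ n"
proof -
  have "(2 * n + 1) * ((3 * n + 1) choose n) = (3 * n + 1) * ((3 * n) choose n)"
    using binomial_absorb_comp[of "3 * n + 1" n] by simp
  then have "real (2 * n + 1) * real ((3 * n + 1) choose n) = real (3 * n + 1) * real ((3 * n) choose n)"
    by (metis of_nat_mult)
  then have "1 / real (3 * n + 1) * real ((3 * n + 1) choose n) = dcoef n"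
    unfolding dcoef_def by (simp add: field_simps)
  then show ?thesis
    using fp_prob_eq[of n 1 \<rho>] by simp
qed

section \<open>Bernoulli configurations\<close>

lemma measurable_psum:
  assumes "\<And>i. (\<lambda>\<eta>. f \<eta> i) \<in> measurable M (count_space UNIV)"
  shows "(\<lambda>\<eta>. psum (f \<eta>) k) \<in> measurable M (count_space UNIV)"
proof -
  have sum: "(\<lambda>\<eta>. \<Sum>i\<in>A. f \<eta> i) \<in> measurable M (count_space UNIV)" if "finite A" for A
    using that
  proof induction
    case (insert a A)
    note [measurable] = assms insert.IH
    have "(\<lambda>\<eta>. (\<lambda>(x, y). x + y) (f \<eta> a, \<Sum>i\<in>A. f \<eta> i)) \<in> measurable M (count_space UNIV)"
      by measurable
    with insert show ?case by simp
  qed simp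
  have "(\<lambda>\<eta>. - (\<Sum>i\<in>{k<..0}. f \<eta> i)) \<in> measurable M (count_space UNIV)"
    by (rule measurable_compose[OF sum]) simp_all
  then show ?thesis
    unfolding psum_def using sum by (cases "0 \<le> k") simp_all
qed

text \<open>The exponential moment of \<open>n\<close> steps; the base on the right is that of a
  single step, and splitting off the first letter produces one factor.\<close>

lemma sum_weight_power_int:
  fixes z :: real
  assumes "0 < z"
  shows "(\<Sum>w | length w = n. weight \<rho> w * z powi (\<Sum>b\<leftarrow>w. walk_step b)) =
    (\<rho> / z + (1 - \<rho>) * z\<^sup>2) ^ n"
proof (induction n)
  case (Suc n)
  let ?L = "{w :: bool list. length w = n}"
  let ?f = "\<lambda>w. weight \<rho> w * z powi (\<Sum>b\<leftarrow>w. walk_step b)"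
  have step: "walk_step True = - 1" "walk_step False = 2"
    by (simp_all add: walk_step_def)
  have "{w :: bool list. length w = Suc n} = (#) True ` ?L \<union> (#) False ` ?L"
    by (auto simp: length_Suc_conv image_iff)
  then have "(\<Sum>w | length w = Suc n. ?f w) = (\<Sum>w\<in>?L. ?f (True # w)) + (\<Sum>w\<in>?L. ?f (False # w))"
    by (simp only:) (subst sum.union_disjoint, auto simp: sum.reindex)
  also have "\<dots> = (\<rho> / z) * (\<Sum>w\<in>?L. ?f w) + ((1 - \<rho>) * z\<^sup>2) * (\<Sum>w\<in>?L. ?f w)"
    unfolding sum_distrib_left using assms
    by (intro arg_cong2[where f = "(+)"] sum.cong)
       (simp_all add: step power_int_add power_int_diff power_int_minus field_simps)
  also have "\<dots> = (\<rho> / z + (1 - \<rho>) * z\<^sup>2) ^ Suc n"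
    unfolding Suc by (simp add: distrib_right)
  finally show ?case .
qed simp

locale bernoulli_config =
  fixes \<rho> :: real
  assumes \<rho>_ge_0: "0 \<le> \<rho>" and \<rho>_le_1: "\<rho> \<le> 1"
begin

abbreviation \<mu> :: "(int \<Rightarrow> bool) measure" where
  "\<mu> \<equiv> bernoulli_product \<rho>"

sublocale prob_space \<mu>
  unfolding bernoulli_product_def by (intro prob_space_PiM prob_space_measure_pmf)

lemma space_\<mu> [simp]: "space \<mu> = UNIV"
  by (simp add: bernoulli_product_def space_PiM)

lemma measurable_site [measurable]: "(\<lambda>\<eta>. \<eta> i) \<in> measurable \<mu> (count_space UNIV)"
proof -
  have "(\<lambda>\<eta>. \<eta> i) \<in> measurable \<mu> (measure_pmf (bernoulli_pmf \<rho>))"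
    unfolding bernoulli_product_def by (rule measurable_component_singleton) simp
  then show ?thesis by simp
qed

lemma measurable_walk [measurable]: "(\<lambda>\<eta>. walk \<eta> k) \<in> measurable \<mu> (count_space UNIV)"
  unfolding walk_def by (rule measurable_psum) measurable

lemma measurable_Qset [measurable]: "Measurable.pred \<mu> (\<lambda>\<eta>. q \<in> Qset \<eta>)"
  unfolding Qset_iff by measurable

lemma sets_Vstar [measurable]: "Vstar \<in> sets \<mu>"
proof -
  have "{\<eta> \<in> space \<mu>. 0 \<in> Qset \<eta>} \<in> sets \<mu>" by measurable
  then show ?thesis by (simp add: Vstar_def)
qed

lemma measurable_all_levels [measurable]: "Measurable.pred \<mu> all_levels"
  unfolding all_levels_def by measurable

lemma measurable_Nstar [measurable]: "Nstar k \<in> measurable \<mu> (count_space UNIV)"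
proof -
  \<comment> \<open>Without an indexing, \<open>qpoint\<close> describes an unsatisfiable predicate,
    so it is the same function \<open>c\<close> for all these configurations.\<close>
  define c where "c = (THE q :: int \<Rightarrow> int. False)"
  have *: "Nstar k \<eta> = n \<longleftrightarrow>
     (if \<eta> \<in> Vstar \<and> all_levels \<eta> then \<exists>j. j \<in> Qset \<eta> \<and> walk \<eta> j = - k \<and>
           j + n \<in> Qset \<eta> \<and> walk \<eta> (j + n) = - (k + 1)
      else c (k + 1) - c k = n)" for \<eta> n
  proof (cases "\<eta> \<in> Vstar \<and> all_levels \<eta>")
    case False
    then have "increasing_index q (Qset \<eta>) \<longleftrightarrow> False" for q
      using ex_increasing_index_iff by blast
    then have "qpoint \<eta> = c"
      unfolding qpoint_def c_def by simp
    with False show ?thesis unfolding Nstar_def by auto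
  qed (simp add: Nstar_eq_iff)
  have "{\<eta> \<in> space \<mu>. Nstar k \<eta> = n} \<in> sets \<mu>" for n
    unfolding * by measurable
  then show ?thesis
    by (intro measurable_count_space_eq2_countable[THEN iffD2]) (auto simp: vimage_def)
qed

section \<open>Stationarity and independence of sites\<close>

lemma distr_shift: "distr \<mu> \<mu> (\<lambda>\<eta> i. \<eta> (i + a)) = \<mu>"
  using distr_PiM_reindex[of UNIV "\<lambda>_. measure_pmf (bernoulli_pmf \<rho>)" "\<lambda>i :: int. i + a" UNIV]
  by (simp add: bernoulli_product_def prob_space_measure_pmf inj_on_def restrict_def)

lemma prob_Qset: "prob {\<eta>. q \<in> Qset \<eta>} = prob Vstar"
proof -
  have [measurable]: "(\<lambda>\<eta> i. \<eta> (i + q)) \<in> measurable \<mu> \<mu>"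
  proof -
    have "(\<lambda>\<eta> i. \<eta> (i + q)) \<in> measurable \<mu> (Pi\<^sub>M UNIV (\<lambda>_. measure_pmf (bernoulli_pmf \<rho>)))"
      by (rule measurable_PiM_single') auto
    then show ?thesis by (simp add: bernoulli_product_def)
  qed
  have "prob Vstar = measure (distr \<mu> \<mu> (\<lambda>\<eta> i. \<eta> (i + q))) Vstar"
    by (simp add: distr_shift)
  also have "\<dots> = prob {\<eta>. q \<in> Qset \<eta>}"
    using sets_Vstar by (subst measure_distr) (auto simp: vimage_def Vstar_def Qset_shift)
  finally show ?thesis ..
qed

text \<open>Resampling site \<open>c\<close> independently preserves the product measure. As
  \<open>A\<close> ignores that site, the event pulls back to a rectangle, whose measure
  factorises.\<close>

lemma prob_update:
  assumes A [measurable]: "A \<in> sets \<mu>" and inv: "\<And>\<eta> b. \<eta>(c := b) \<in> A \<longleftrightarrow> \<eta> \<in> A"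
  shows "prob (A \<inter> {\<eta>. \<eta> c = b}) = prob A * (if b then \<rho> else 1 - \<rho>)"
proof -
  let ?B = "measure_pmf (bernoulli_pmf \<rho>)"
  let ?u = "\<lambda>(x, \<eta>). \<eta>(c := x)"
  have D: "distr (?B \<Otimes>\<^sub>M \<mu>) \<mu> ?u = \<mu>"
    using distr_pair_PiM_eq_PiM[of UNIV "\<lambda>_. ?B" c]
    by (simp add: bernoulli_product_def prob_space_measure_pmf)
  have u: "?u \<in> measurable (?B \<Otimes>\<^sub>M \<mu>) \<mu>"
  proof -
    have "(\<lambda>p. (snd p)(c := fst p)) \<in> measurable (?B \<Otimes>\<^sub>M Pi\<^sub>M UNIV (\<lambda>_. ?B)) (Pi\<^sub>M (insert c UNIV) (\<lambda>_. ?B))"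
      by (rule measurable_fun_upd[where J = UNIV]) auto
    then show ?thesis
      by (simp add: bernoulli_product_def case_prod_beta)
  qed
  have S: "A \<inter> {\<eta>. \<eta> c = b} \<in> sets \<mu>"
  proof -
    have "A \<inter> {\<eta> \<in> space \<mu>. \<eta> c = b} \<in> sets \<mu>" by measurable
    then show ?thesis by simp
  qed
  have "emeasure \<mu> (A \<inter> {\<eta>. \<eta> c = b}) = emeasure (distr (?B \<Otimes>\<^sub>M \<mu>) \<mu> ?u) (A \<inter> {\<eta>. \<eta> c = b})"
    by (simp only: D)
  also have "\<dots> = emeasure (?B \<Otimes>\<^sub>M \<mu>) (?u -` (A \<inter> {\<eta>. \<eta> c = b}) \<inter> space (?B \<Otimes>\<^sub>M \<mu>))"
    by (rule emeasure_distr[OF u S])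
  also have "?u -` (A \<inter> {\<eta>. \<eta> c = b}) \<inter> space (?B \<Otimes>\<^sub>M \<mu>) = {b} \<times> A"
    by (auto simp: space_pair_measure inv)
  also have "emeasure (?B \<Otimes>\<^sub>M \<mu>) ({b} \<times> A) = emeasure ?B {b} * emeasure \<mu> A"
    by (rule emeasure_pair_measure_Times) auto
  also have "\<dots> = ennreal (prob A * (if b then \<rho> else 1 - \<rho>))"
    using \<rho>_ge_0 \<rho>_le_1
    by (simp add: emeasure_pmf_single emeasure_eq_measure ennreal_mult'[symmetric] mult.commute)
  finally show ?thesis
    using \<rho>_ge_0 \<rho>_le_1 by (simp add: emeasure_eq_measure)
qed

lemma sets_word [measurable]: "{\<eta>. word \<eta> a n \<in> F} \<in> sets \<mu>"
proof -
  have 1: "{\<eta>. word \<eta> a n = w} \<in> sets \<mu>" for w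
  proof (induction n arbitrary: w)
    case 0
    then show ?case using sets.top[of \<mu>] by (cases "w = []") auto
  next
    case (Suc n)
    show ?case
    proof (cases w rule: rev_cases)
      case (snoc v b)
      have "{\<eta>. word \<eta> a n = v} \<inter> {\<eta> \<in> space \<mu>. \<eta> (a + 1 + int n) = b} \<in> sets \<mu>"
        using Suc.IH[of v] by measurable
      moreover have "{\<eta>. word \<eta> a (Suc n) = w} =
          {\<eta>. word \<eta> a n = v} \<inter> {\<eta> \<in> space \<mu>. \<eta> (a + 1 + int n) = b}"
        by (auto simp: word_snoc snoc)
      ultimately show ?thesis by simp
    qed (simp add: word_snoc)
  qed
  have "{\<eta>. word \<eta> a n \<in> F} = (\<Union>w\<in>F. {\<eta>. word \<eta> a n = w})"
    by auto
  with 1 show ?thesis by auto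
qed

text \<open>The word grows at its right end: each new site lies outside the past of \<open>A\<close>
  and the letters already read, so \<open>prob_update\<close> contributes one factor.\<close>

lemma prob_word:
  assumes A: "A \<in> sets \<mu>" and past: "\<And>\<eta> \<eta>'. (\<And>k. k \<le> a \<Longrightarrow> \<eta> k = \<eta>' k) \<Longrightarrow> \<eta> \<in> A \<Longrightarrow> \<eta>' \<in> A"
  shows "prob (A \<inter> {\<eta>. word \<eta> a (length w) = w}) = prob A * weight \<rho> w"
proof (induction w rule: rev_induct)
  case Nil
  show ?case by simp
next
  case (snoc b w)
  let ?A = "A \<inter> {\<eta>. word \<eta> a (length w) = w}"
  have "?A \<in> sets \<mu>"
    using A sets_word[of a "length w" "{w}"] by auto
  moreover have "\<eta>(a + 1 + int (length w) := c) \<in> ?A \<longleftrightarrow> \<eta> \<in> ?A" for \<eta> c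
  proof -
    have "\<eta>(a + 1 + int (length w) := c) \<in> A \<longleftrightarrow> \<eta> \<in> A"
      using past[of \<eta> "\<eta>(a + 1 + int (length w) := c)"] past[of "\<eta>(a + 1 + int (length w) := c)" \<eta>]
      by auto
    moreover have "word (\<eta>(a + 1 + int (length w) := c)) a (length w) = word \<eta> a (length w)"
      by (auto simp: word_def)
    ultimately show ?thesis by simp
  qed
  ultimately have "prob (?A \<inter> {\<eta>. \<eta> (a + 1 + int (length w)) = b}) =
      prob ?A * (if b then \<rho> else 1 - \<rho>)"
    by (rule prob_update)
  moreover have "A \<inter> {\<eta>. word \<eta> a (length (w @ [b])) = w @ [b]} =
      ?A \<inter> {\<eta>. \<eta> (a + 1 + int (length w)) = b}"
    by (auto simp: word_snoc)
  ultimately show ?case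
    using snoc by simp
qed

lemma prob_word_in:
  assumes "A \<in> sets \<mu>" "\<And>\<eta> \<eta>'. (\<And>k. k \<le> a \<Longrightarrow> \<eta> k = \<eta>' k) \<Longrightarrow> \<eta> \<in> A \<Longrightarrow> \<eta>' \<in> A"
    and F: "F \<subseteq> {w. length w = n}"
  shows "prob (A \<inter> {\<eta>. word \<eta> a n \<in> F}) = prob A * (\<Sum>w\<in>F. weight \<rho> w)"
proof -
  have fin: "finite F"
    using F finite_words by (rule finite_subset)
  have "A \<inter> {\<eta>. word \<eta> a n \<in> F} = (\<Union>w\<in>F. A \<inter> {\<eta>. word \<eta> a n = w})"
    by auto
  also have "prob \<dots> = (\<Sum>w\<in>F. prob (A \<inter> {\<eta>. word \<eta> a n = w}))"
  proof (rule finite_measure_finite_Union[OF fin])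
    show "(\<lambda>w. A \<inter> {\<eta>. word \<eta> a n = w}) ` F \<subseteq> events"
      using assms(1) sets_word[of a n "{w}" for w] by auto
  qed (auto simp: disjoint_family_on_def)
  also have "\<dots> = (\<Sum>w\<in>F. prob A * weight \<rho> w)"
  proof (rule sum.cong[OF refl])
    fix w assume "w \<in> F"
    with F have n: "n = length w" by auto
    show "prob (A \<inter> {\<eta>. word \<eta> a n = w}) = prob A * weight \<rho> w"
      unfolding n by (rule prob_word[OF assms(1,2)])
  qed
  finally show ?thesis by (simp add: sum_distrib_left)
qed

lemma weight_nonneg: "0 \<le> weight \<rho> w"
  using \<rho>_ge_0 \<rho>_le_1 by (induction w) auto

text \<open>Chernoff bound: on the event, \<open>z\<close> to the power of the excess over
  \<open>c\<close> is at least 1. The bound is uniform in the starting site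
  \<open>a\<close>.\<close>

lemma prob_walk_ge:
  fixes z :: real
  assumes z: "1 < z"
  shows "prob {\<eta>. c \<le> walk \<eta> (a + int n) - walk \<eta> a} \<le>
    (\<rho> / z + (1 - \<rho>) * z\<^sup>2) ^ n * z powi (- c)"
proof -
  let ?L = "{w :: bool list. length w = n}"
  let ?s = "\<lambda>w. \<Sum>b\<leftarrow>w. walk_step b"
  have "prob {\<eta>. c \<le> walk \<eta> (a + int n) - walk \<eta> a} =
      prob (UNIV \<inter> {\<eta>. word \<eta> a n \<in> {w \<in> ?L. c \<le> ?s w}})"
    by (simp add: walk_word)
  also have "\<dots> = (\<Sum>w\<in>{w \<in> ?L. c \<le> ?s w}. weight \<rho> w)"
    using sets.top[of \<mu>] prob_space by (subst prob_word_in) auto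
  also have "\<dots> \<le> (\<Sum>w\<in>{w \<in> ?L. c \<le> ?s w}. weight \<rho> w * z powi (?s w - c))"
  proof (rule sum_mono)
    fix w assume "w \<in> {w \<in> ?L. c \<le> ?s w}"
    then have "1 \<le> z powi (?s w - c)"
      using z by (simp add: power_int_def)
    then show "weight \<rho> w \<le> weight \<rho> w * z powi (?s w - c)"
      using weight_nonneg[of w] by (simp add: mult_le_cancel_left1)
  qed
  also have "\<dots> \<le> (\<Sum>w\<in>?L. weight \<rho> w * z powi (?s w - c))"
    using z weight_nonneg by (intro sum_mono2) auto
  also have "\<dots> = (\<Sum>w\<in>?L. weight \<rho> w * z powi ?s w) * z powi (- c)"
    using z by (simp add: sum_distrib_right power_int_diff power_int_minus divide_inverse mult.assoc)
  finally show ?thesis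
    using z by (simp add: sum_weight_power_int)
qed

end

section \<open>Negative drift\<close>

locale subcritical_walk = bernoulli_config +
  assumes \<rho>_gt: "2 / 3 < \<rho>" and \<rho>_lt: "\<rho> < 1"
begin

text \<open>At \<open>z = 1\<close> the moment equals 1 and has derivative
  \<open>2 - 3 * \<rho>\<close>, which is negative; hence it is below 1 slightly to the
  right.\<close>

lemma ex_exponential_moment_less_1:
  obtains z :: real where "1 < z" "\<rho> / z + (1 - \<rho>) * z\<^sup>2 < 1"
proof
  \<comment> \<open>Chosen so that \<open>2 + 4 * e = 3 * \<rho>\<close>.\<close>
  define e where "e = (3 * \<rho> - 2) / 4"
  have e: "0 < e" "e < 1"
    using \<rho>_gt \<rho>_lt by (simp_all add: e_def)
  then show "1 < 1 + e" by simp
  \<comment> \<open>The goal at \<open>z = 1 + e\<close> after clearing the denominator and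
    cancelling a factor \<open>e\<close>.\<close>
  have "(1 - \<rho>) * ((1 + e) * (2 + e)) < \<rho>"
  proof -
    have "e * e < e * 1"
      using e by (intro mult_strict_left_mono) auto
    then have "(1 + e) * (2 + e) < 2 + 4 * e"
      by (simp add: algebra_simps)
    then have "(1 - \<rho>) * ((1 + e) * (2 + e)) < (1 - \<rho>) * (2 + 4 * e)"
      using \<rho>_lt by (intro mult_strict_left_mono) auto
    also have "2 + 4 * e = 3 * \<rho>"
      by (simp add: e_def field_simps)
    also have "(1 - \<rho>) * (3 * \<rho>) = (3 - 3 * \<rho>) * \<rho>"
      by (simp add: algebra_simps)
    also have "\<dots> < 1 * \<rho>"
      using \<rho>_gt by (intro mult_strict_right_mono) auto
    also have "1 * \<rho> = \<rho>"
      by simp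
    finally show ?thesis .
  qed
  then have "e * ((1 - \<rho>) * ((1 + e) * (2 + e))) < e * \<rho>"
    using e by (intro mult_strict_left_mono)
  then have "\<rho> + (1 - \<rho>) * (1 + e) ^ 3 < 1 + e"
    by (simp add: algebra_simps power3_eq_cube)
  then show "\<rho> / (1 + e) + (1 - \<rho>) * (1 + e)\<^sup>2 < 1"
    using e by (simp add: field_simps power2_eq_square power3_eq_cube)
qed

text \<open>Borel-Cantelli for the geometric bound of \<open>prob_walk_ge\<close>. Starting points
  depending on \<open>n\<close> let one statement cover both ends: \<open>a n = 0\<close> for the
  right, \<open>a n = - int n\<close> for the left.\<close>

lemma AE_eventually_walk_less:
  "AE \<eta> in \<mu>. \<forall>\<^sub>F n in sequentially. walk \<eta> (a n + int n) - walk \<eta> (a n) < c"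
proof -
  obtain z :: real where z: "1 < z" "\<rho> / z + (1 - \<rho>) * z\<^sup>2 < 1"
    by (rule ex_exponential_moment_less_1)
  define r where "r = \<rho> / z + (1 - \<rho>) * z\<^sup>2"
  have r: "0 \<le> r" "r < 1"
    using z \<rho>_ge_0 \<rho>_le_1 by (simp_all add: r_def)
  let ?A = "\<lambda>n. {\<eta>. c \<le> walk \<eta> (a n + int n) - walk \<eta> (a n)}"
  have meas: "?A n \<in> sets \<mu>" for n
  proof -
    have "{\<eta> \<in> space \<mu>. c \<le> walk \<eta> (a n + int n) - walk \<eta> (a n)} \<in> sets \<mu>" by measurable
    then show ?thesis by simp
  qed
  have "summable (\<lambda>n. r ^ n * z powi (- c))"
    using r by (intro summable_mult2 summable_geometric) simp
  then have "summable (\<lambda>n. prob (?A n))"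
    by (rule summable_comparison_test'[where N = 0])
       (use prob_walk_ge[OF z(1)] in \<open>simp add: r_def\<close>)
  then have "AE \<eta> in \<mu>. \<forall>\<^sub>F n in sequentially. \<eta> \<in> space \<mu> - ?A n"
    by (intro borel_cantelli_AE1 meas) (simp_all add: emeasure_eq_measure)
  then show ?thesis
    by (rule AE_mp) (auto simp: not_le elim!: eventually_mono)
qed

lemma AE_all_levels: "AE \<eta> in \<mu>. all_levels \<eta>"
proof -
  have "AE \<eta> in \<mu>. \<forall>c. \<forall>\<^sub>F n in sequentially. walk \<eta> (0 + int n) - walk \<eta> 0 < c"
    unfolding AE_all_countable by (rule allI, rule AE_eventually_walk_less)
  moreover have "AE \<eta> in \<mu>. \<forall>c. \<forall>\<^sub>F n in sequentially. walk \<eta> (- int n + int n) - walk \<eta> (- int n) < c"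
    unfolding AE_all_countable by (rule allI, rule AE_eventually_walk_less)
  ultimately show ?thesis
  proof eventually_elim
    case (elim \<eta>)
    show ?case
    proof (rule all_levelsI)
      fix c
      \<comment> \<open>The increment ends at 0, where the walk vanishes, so a bound below
        \<open>- c\<close> puts the walk above \<open>c\<close> at the start.\<close>
      obtain N where N: "\<And>n. N \<le> n \<Longrightarrow> walk \<eta> (- int n + int n) - walk \<eta> (- int n) < - c"
        using elim(2)[rule_format, of "- c"] unfolding eventually_sequentially by blast
      have "c < walk \<eta> i" if "i \<le> - int N" for i
        using N[of "nat (- i)"] that by simp
      then show "\<exists>a. \<forall>i\<le>a. c < walk \<eta> i" by blast
      obtain n where "walk \<eta> (0 + int n) - walk \<eta> 0 < c"
        using elim(1)[rule_format, of c] unfolding eventually_sequentially by blast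
      then show "\<exists>i. walk \<eta> i \<le> c"
        by (intro exI[of _ "int n"]) simp
    qed
  qed
qed

lemma prob_Vstar_pos: "0 < prob Vstar"
proof (rule ccontr)
  assume "\<not> 0 < prob Vstar"
  then have 0: "prob Vstar = 0"
    using measure_nonneg[of \<mu> Vstar] by simp
  have "AE \<eta> in \<mu>. q \<notin> Qset \<eta>" for q
  proof (rule AE_I[where N = "{\<eta>. q \<in> Qset \<eta>}"])
    have "{\<eta> \<in> space \<mu>. q \<in> Qset \<eta>} \<in> sets \<mu>" by measurable
    then show "{\<eta>. q \<in> Qset \<eta>} \<in> sets \<mu>" by simp
    show "emeasure \<mu> {\<eta>. q \<in> Qset \<eta>} = 0"
      by (simp add: emeasure_eq_measure prob_Qset 0)
  qed auto
  then have "AE \<eta> in \<mu>. \<forall>q. q \<notin> Qset \<eta>"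
    unfolding AE_all_countable ..
  with AE_all_levels have "AE \<eta> in \<mu>. False"
    by eventually_elim (auto simp: all_levels_def)
  then show False by simp
qed

text \<open>The event is determined by the sites up to the last point of the chain, so each further gap
  contributes an independent first-passage factor. It is stated with differences because
  \<open>walk \<eta> (c j)\<close> alone involves the sites up to 0 when \<open>c j < 0\<close>.\<close>

lemma prob_record_chain:
  assumes c: "\<And>j. c (j + 1) = c j + int (x j)"
  shows "prob {\<eta>. \<forall>j\<in>{m..m + int k}. c j \<in> Qset \<eta> \<and> walk \<eta> (c j) - walk \<eta> (c m) = m - j} =
    prob Vstar * (\<Prod>j\<in>{m..<m + int k}. fp_prob \<rho> 1 (x j))"
proof (induction k)
  case 0
  have "{\<eta>. \<forall>j\<in>{m..m + int 0}. c j \<in> Qset \<eta> \<and> walk \<eta> (c j) - walk \<eta> (c m) = m - j} = {\<eta>. c m \<in> Qset \<eta>}"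
    by auto
  then show ?case by (simp add: prob_Qset)
next
  case (Suc k)
  let ?P = "\<lambda>\<eta> j. c j \<in> Qset \<eta> \<and> walk \<eta> (c j) - walk \<eta> (c m) = m - j"
  let ?D = "\<lambda>k. {\<eta>. \<forall>j\<in>{m..m + int k}. ?P \<eta> j}"
  define l where "l = m + int k"
  have meas: "?D k \<in> sets \<mu>"
  proof -
    have "{\<eta> \<in> space \<mu>. \<forall>j\<in>{m..m + int k}. ?P \<eta> j} \<in> sets \<mu>" by measurable
    then show ?thesis by simp
  qed
  have mono: "c i \<le> c j" if "i \<le> j" for i j
    using that by (induction j rule: int_ge_induct) (auto simp: c)
  \<comment> \<open>All points of the chain lie at or before \<open>c l\<close>, so the sites up to
    \<open>c l\<close> settle whether they are records and how their levels differ.\<close>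
  have past: "\<eta>' \<in> ?D k" if eq: "\<And>k. k \<le> c l \<Longrightarrow> \<eta> k = \<eta>' k" and D: "\<eta> \<in> ?D k" for \<eta> \<eta>'
  proof -
    have "?P \<eta>' j" if j: "j \<in> {m..m + int k}" for j
    proof -
      have "c j \<le> c l" "c m \<le> c l"
        using j by (auto simp: l_def intro!: mono)
      then show ?thesis
        using D j Qset_cong[of "c l" \<eta> \<eta>' "c j", OF eq] walk_diff_cong[of "c l" \<eta> \<eta>' "c m" "c j", OF eq]
        by auto
    qed
    then show ?thesis by simp
  qed
  have "?D (Suc k) = ?D k \<inter> {\<eta>. word \<eta> (c l) (x l) \<in> fp_words 1 (x l)}"
  proof -
    have split: "{m..m + int (Suc k)} = insert (l + 1) {m..m + int k}"
      by (auto simp: l_def)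
    have "?P \<eta> (l + 1) \<longleftrightarrow> first_passage 1 (word \<eta> (c l) (x l))" if "\<eta> \<in> ?D k" for \<eta>
    proof -
      have "?P \<eta> l" using that by (simp add: l_def)
      then show ?thesis
        using first_passage_Qset[of "c l" \<eta> "x l"] by (auto simp: c)
    qed
    then show ?thesis
      unfolding split by (auto simp: fp_words_def)
  qed
  moreover have "prob (?D k \<inter> {\<eta>. word \<eta> (c l) (x l) \<in> fp_words 1 (x l)}) =
      prob (?D k) * fp_prob \<rho> 1 (x l)"
    unfolding fp_prob_def by (rule prob_word_in[OF meas past]) (auto simp: fp_words_def)
  ultimately have "prob (?D (Suc k)) = prob (?D k) * fp_prob \<rho> 1 (x l)"
    by (simp only:)
  moreover have "{m..<m + int (Suc k)} = insert l {m..<m + int k}"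
    by (auto simp: l_def)
  ultimately show ?case
    unfolding Suc by (simp add: l_def)
qed

text \<open>Forwards, the points are identified by induction from index 0 in both directions.
  Conversely, the condition at \<open>j = 0\<close> yields \<open>Vstar\<close> and turns level
  differences into levels. Both use that the window contains 0.\<close>

lemma Nstar_record_chain:
  assumes V: "all_levels \<eta>" and c: "c 0 = 0" "\<And>j. c (j + 1) = c j + x j" and m: "m \<le> 0" "0 \<le> M"
  shows "(\<eta> \<in> Vstar \<and> (\<forall>j\<in>{m..<M}. Nstar j \<eta> = x j)) \<longleftrightarrow>
    (\<forall>j\<in>{m..M}. c j \<in> Qset \<eta> \<and> walk \<eta> (c j) - walk \<eta> (c m) = m - j)" (is "?L \<longleftrightarrow> ?R")
proof
  assume L: ?L
  then have qp: "qpoint \<eta> k = j \<longleftrightarrow> j \<in> Qset \<eta> \<and> walk \<eta> j = - k" for k j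
    using qpoint_eq_iff V by blast
  have q: "m \<le> i \<and> i \<le> M \<longrightarrow> qpoint \<eta> i = c i" for i
  proof (induction i rule: int_induct[where k = 0])
    case base
    then show ?case using L by (simp add: qp c Vstar_def)
  next
    case (step1 i)
    show ?case
    proof
      assume i: "m \<le> i + 1 \<and> i + 1 \<le> M"
      then have "Nstar i \<eta> = x i" using L step1(1) m by auto
      then show "qpoint \<eta> (i + 1) = c (i + 1)"
        using step1 i m unfolding Nstar_def by (simp add: c)
    qed
  next
    case (step2 i)
    show ?case
    proof
      assume i: "m \<le> i - 1 \<and> i - 1 \<le> M"
      then have "Nstar (i - 1) \<eta> = x (i - 1)" using L step2(1) m by auto
      then show "qpoint \<eta> (i - 1) = c (i - 1)"
        using step2 i m c(2)[of "i - 1"] unfolding Nstar_def by simp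
    qed
  qed
  then have "c j \<in> Qset \<eta> \<and> walk \<eta> (c j) = - j" if "j \<in> {m..M}" for j
    using qp[of j "c j"] that by auto
  then show ?R using m by auto
next
  assume R: ?R
  then have *: "0 \<in> Qset \<eta>" "walk \<eta> (c m) = - m"
    using m c(1) by (auto dest: bspec[of _ _ 0])
  then have V': "\<eta> \<in> Vstar" by (simp add: Vstar_def)
  have "Nstar j \<eta> = x j" if j: "j \<in> {m..<M}" for j
    using R[rule_format, of j] R[rule_format, of "j + 1"] j *(2)
    by (simp add: Nstar_eq_iff[OF V' V]) (metis c(2))
  with V' show ?L by blast
qed

section \<open>Joint law of the gaps in a window around 0\<close>

definition gap_prob :: "int \<Rightarrow> real" where
  "gap_prob n = (if 0 < n then fp_prob \<rho> 1 (nat n) else 0)"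

lemma gap_prob_nonneg: "0 \<le> gap_prob n"
  by (auto simp: gap_prob_def fp_prob_def intro!: sum_nonneg weight_nonneg)

lemma sets_Nstar_eq: "finite I \<Longrightarrow> {\<eta>. \<forall>j\<in>I. Nstar j \<eta> = x j} \<in> sets \<mu>"
proof -
  assume [simp]: "finite I"
  have "{\<eta> \<in> space \<mu>. \<forall>j\<in>I. Nstar j \<eta> = x j} \<in> sets \<mu>" by measurable
  then show ?thesis by simp
qed

text \<open>Up to a null set the event is a chain of records, whose probability is known wherever
  the chain starts; letting it start left of 0 treats negative and nonnegative indices
  alike.\<close>

lemma prob_gaps:
  assumes m: "m \<le> 0" "0 \<le> M"
  shows "prob (Vstar \<inter> {\<eta>. \<forall>j\<in>{m..<M}. Nstar j \<eta> = x j}) =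
    prob Vstar * (\<Prod>j\<in>{m..<M}. gap_prob (x j))" (is "prob ?E = _")
proof (cases "\<forall>j\<in>{m..<M}. 0 < x j")
  case False
  then obtain j where j: "j \<in> {m..<M}" "x j \<le> 0" by force
  have "AE \<eta> in \<mu>. \<eta> \<notin> ?E"
    using AE_all_levels
  proof eventually_elim
    case (elim \<eta>)
    then show ?case using Nstar_pos[of \<eta> j] j by force
  qed
  then have "prob ?E = 0"
    using sets_Nstar_eq[of "{m..<M}" x] by (intro prob_eq_0[THEN iffD2]) auto
  moreover have "(\<Prod>j\<in>{m..<M}. gap_prob (x j)) = 0"
    using j by (intro prod_zero bexI[of _ j]) (auto simp: gap_prob_def)
  ultimately show ?thesis by simp
next
  case True
  \<comment> \<open>Gaps outside the window are set to 0, which affects no point \<open>c j\<close>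
    with \<open>j\<close> in \<open>{m..M}\<close>.\<close>
  define y where "y j = nat (if j \<in> {m..<M} then x j else 0)" for j
  \<comment> \<open>\<open>psum\<close> adds the term at \<open>j + 1\<close> when passing from
    \<open>j\<close>, so the shift by one makes \<open>y j\<close> the gap after
    \<open>c j\<close>.\<close>
  define c where "c = psum (\<lambda>j. int (y (j - 1)))"
  have c: "c 0 = 0" "c (j + 1) = c j + int (y j)" for j
    by (simp_all add: c_def psum_Suc)
  have y: "int (y j) = x j" if "j \<in> {m..<M}" for j
    using True that by (force simp: y_def)
  let ?D = "{\<eta>. \<forall>j\<in>{m..M}. c j \<in> Qset \<eta> \<and> walk \<eta> (c j) - walk \<eta> (c m) = m - j}"
  have D: "?D \<in> sets \<mu>"
  proof -
    have "{\<eta> \<in> space \<mu>. \<forall>j\<in>{m..M}. c j \<in> Qset \<eta> \<and> walk \<eta> (c j) - walk \<eta> (c m) = m - j} \<in> sets \<mu>"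
      by measurable
    then show ?thesis by simp
  qed
  have "prob ?E = prob ?D"
  proof (rule finite_measure_eq_AE)
    show "AE \<eta> in \<mu>. \<eta> \<in> ?E \<longleftrightarrow> \<eta> \<in> ?D"
      using AE_all_levels
    proof eventually_elim
      case (elim \<eta>)
      have "(\<forall>j\<in>{m..<M}. Nstar j \<eta> = x j) \<longleftrightarrow> (\<forall>j\<in>{m..<M}. Nstar j \<eta> = int (y j))"
        using y by auto
      then show ?case
        using Nstar_record_chain[OF elim c m] by simp
    qed
  qed (use sets_Nstar_eq[of "{m..<M}" x] D in auto)
  also have "\<dots> = prob Vstar * (\<Prod>j\<in>{m..<M}. fp_prob \<rho> 1 (y j))"
    using prob_record_chain[where c = c and x = y and m = m and k = "nat (M - m)", OF c(2)] m by simp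
  also have "(\<Prod>j\<in>{m..<M}. fp_prob \<rho> 1 (y j)) = (\<Prod>j\<in>{m..<M}. gap_prob (x j))"
    using True by (intro prod.cong) (auto simp: gap_prob_def y_def)
  finally show ?thesis .
qed

end

section \<open>Independence from joint point probabilities\<close>

text \<open>Sums out the indices in \<open>K\<close> one at a time, using that \<open>f\<close> has
  total mass 1. It extends a joint formula from windows to arbitrary finite index sets.\<close>

lemma (in prob_space) joint_pmf_marginal:
  fixes X :: "'i \<Rightarrow> 'a \<Rightarrow> 'b :: countable" and f :: "'b \<Rightarrow> real"
  assumes X [measurable]: "\<And>i. X i \<in> measurable M (count_space UNIV)"
    and f: "\<And>n. 0 \<le> f n" "(\<integral>\<^sup>+n. ennreal (f n) \<partial>count_space UNIV) = 1"
    and "finite K" "finite J" "J \<inter> K = {}"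
    and joint: "\<And>x. prob {\<omega>\<in>space M. \<forall>i\<in>J \<union> K. X i \<omega> = x i} = (\<Prod>i\<in>J \<union> K. f (x i))"
  shows "prob {\<omega>\<in>space M. \<forall>i\<in>J. X i \<omega> = x i} = (\<Prod>i\<in>J. f (x i))"
  using assms(4-)
proof (induction K arbitrary: J x rule: finite_induct)
  case (insert k K)
  let ?S = "\<lambda>J x. {\<omega>\<in>space M. \<forall>i\<in>J. X i \<omega> = x i}"
  have k: "k \<notin> J" using insert.prems by auto
  have insert_k: "prob (?S (insert k J) y) = f (y k) * (\<Prod>i\<in>J. f (y i))" for y
    using insert.IH[of "insert k J" y] insert.prems insert.hyps k by simp
  have sets: "?S I y \<in> sets M" if "finite I" for I y
    using that by measurable
  have "?S J x = (\<Union>n. ?S (insert k J) (x(k := n)))"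
    using k by (auto simp: fun_upd_def)
  then have "emeasure M (?S J x) = emeasure M (\<Union>n. ?S (insert k J) (x(k := n)))"
    by simp
  also have "\<dots> = (\<integral>\<^sup>+n. emeasure M (?S (insert k J) (x(k := n))) \<partial>count_space UNIV)"
    using insert.prems(1) sets
    by (intro emeasure_UN_countable) (auto simp: disjoint_family_on_def)
  also have "\<dots> = (\<integral>\<^sup>+n. ennreal (f n) * ennreal (\<Prod>i\<in>J. f (x i)) \<partial>count_space UNIV)"
  proof (rule nn_integral_cong)
    fix n
    have "(\<Prod>i\<in>J. f ((x(k := n)) i)) = (\<Prod>i\<in>J. f (x i))"
      using k by (intro prod.cong) auto
    then show "emeasure M (?S (insert k J) (x(k := n))) = ennreal (f n) * ennreal (\<Prod>i\<in>J. f (x i))"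
      unfolding emeasure_eq_measure insert_k using f(1) by (simp add: ennreal_mult prod_nonneg)
  qed
  also have "\<dots> = ennreal (\<Prod>i\<in>J. f (x i))"
    by (simp add: nn_integral_multc f(2))
  finally show ?case
    using f(1) by (simp add: emeasure_eq_measure prod_nonneg)
qed simp

text \<open>Singletons \<open>J\<close> show that \<open>f\<close> gives the point probabilities of
  each variable, so the joint formula is independence of the point events, and these
  generate.\<close>

lemma (in prob_space) indep_vars_joint_pmf:
  fixes X :: "'i \<Rightarrow> 'a \<Rightarrow> 'b :: countable" and f :: "'b \<Rightarrow> real"
  assumes X [measurable]: "\<And>i. X i \<in> measurable M (count_space UNIV)"
    and joint: "\<And>J x. finite J \<Longrightarrow> prob {\<omega>\<in>space M. \<forall>i\<in>J. X i \<omega> = x i} = (\<Prod>i\<in>J. f (x i))"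
  shows "indep_vars (\<lambda>_. count_space UNIV) X UNIV"
proof -
  define S where "S i n = X i -` {n} \<inter> space M" for i n
  have S: "S i n \<in> events" for i n
    unfolding S_def by measurable
  \<comment> \<open>The empty set makes the point events of one variable stable under
    intersection.\<close>
  define F where "F i = insert {} (range (S i))" for i
  have prob_S: "prob (S i n) = f n" for i n
    using joint[of "{i}" "\<lambda>_. n"] by (simp add: S_def vimage_def Int_def conj_commute)
  have "indep_sets F UNIV"
  proof (rule indep_setsI)
    fix A J assume J: "J \<noteq> {}" "finite J" and A: "\<forall>j\<in>J. A j \<in> F j"
    show "prob (\<Inter>j\<in>J. A j) = (\<Prod>j\<in>J. prob (A j))"
    proof (cases "\<exists>j\<in>J. A j = {}")
      case True
      then obtain j where "j \<in> J" "A j = {}" by blast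
      then have "(\<Inter>j\<in>J. A j) = {}" "(\<Prod>j\<in>J. prob (A j)) = 0"
        using J by (auto intro!: bexI[of _ j])
      then show ?thesis by simp
    next
      case False
      then have "\<exists>n. A j = S j n" if "j \<in> J" for j
        using A that by (auto simp: F_def image_iff)
      then obtain x where x: "\<And>j. j \<in> J \<Longrightarrow> A j = S j (x j)"
        by metis
      then have "(\<Inter>j\<in>J. A j) = {\<omega>\<in>space M. \<forall>i\<in>J. X i \<omega> = x i}"
        using J by (auto simp: S_def)
      then show ?thesis
        using joint[OF J(2)] x by (simp add: prob_S)
    qed
  qed (use S in \<open>auto simp: F_def\<close>)
  moreover have "Int_stable (F i)" for i
    by (auto simp: Int_stable_def F_def S_def)
  ultimately have "indep_sets (\<lambda>i. sigma_sets (space M) (F i)) UNIV"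
    by (rule indep_sets_sigma)
  then have "indep_sets (\<lambda>i. {X i -` A \<inter> space M |A. A \<in> sets (count_space UNIV)}) UNIV"
  proof (rule indep_sets_mono_sets)
    fix i
    \<comment> \<open>Every subset of a countable type is a countable union of points.\<close>
    have "X i -` A \<inter> space M \<in> sigma_sets (space M) (F i)" for A
    proof -
      have "(\<Union>n\<in>A. S i n) \<in> sigma_sets (space M) (F i)"
      proof (rule sigma_sets_UNION)
        show "countable (S i ` A)" by simp
      qed (auto simp: F_def)
      also have "(\<Union>n\<in>A. S i n) = X i -` A \<inter> space M"
        by (auto simp: S_def)
      finally show ?thesis .
    qed
    then show "{X i -` A \<inter> space M |A. A \<in> sets (count_space UNIV)} \<subseteq> sigma_sets (space M) (F i)"
      by blast
  qed
  then show ?thesis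
    unfolding indep_vars_def2 using X by auto
qed

theorem theorem4p2:
  fixes \<rho> :: real
  assumes "2 / 3 < \<rho>" and "\<rho> < 1"
  shows "prob_space.indep_vars (mu_star \<rho>) (\<lambda>_. count_space UNIV) Nstar (UNIV :: int set)
    \<and> (\<forall>j k. distr (mu_star \<rho>) (count_space UNIV) (Nstar j)
            = distr (mu_star \<rho>) (count_space UNIV) (Nstar k))
    \<and> (\<forall>k. \<forall>n :: nat.
         measure (mu_star \<rho>) {\<eta> \<in> space (mu_star \<rho>). Nstar k \<eta> = 3 * int n + 1}
           = dcoef n * \<rho> ^ (2 * n + 1) * (1 - \<rho>) ^ n)"
proof -
  interpret subcritical_walk \<rho>
    using assms by unfold_locales auto
  have nz: "emeasure (bernoulli_product \<rho>) Vstar \<noteq> 0" "emeasure (bernoulli_product \<rho>) Vstar \<noteq> \<infinity>"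
    using prob_Vstar_pos by (simp_all add: emeasure_eq_measure)
  have sp: "space (mu_star \<rho>) = UNIV"
    by (simp add: mu_star_def)
  interpret star: prob_space "mu_star \<rho>"
    unfolding mu_star_def using nz by (rule prob_space_uniform_measure)
  have meas: "Nstar k \<in> measurable (mu_star \<rho>) (count_space UNIV)" for k
    unfolding mu_star_def using measurable_Nstar[of k]
    by (simp add: measurable_cong_sets[OF sets_uniform_measure refl])
  \<comment> \<open>Conditioning divides by \<open>prob Vstar\<close>, which cancels the prefactor
    in \<open>prob_gaps\<close>.\<close>
  have window: "measure (mu_star \<rho>) {\<eta> \<in> space (mu_star \<rho>). \<forall>i\<in>{m..<M}. Nstar i \<eta> = x i} =
      (\<Prod>i\<in>{m..<M}. gap_prob (x i))" if "m \<le> 0" "0 \<le> M" for m M x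
  proof -
    have "measure (mu_star \<rho>) {\<eta>. \<forall>i\<in>{m..<M}. Nstar i \<eta> = x i} =
        prob (Vstar \<inter> {\<eta>. \<forall>i\<in>{m..<M}. Nstar i \<eta> = x i}) / prob Vstar"
      unfolding mu_star_def using sets_Nstar_eq nz by (intro measure_uniform_measure) auto
    then show ?thesis
      using prob_gaps[OF that] prob_Vstar_pos by (simp add: sp)
  qed
  \<comment> \<open>By the window \<open>{0..<1}\<close> these are the point probabilities of
    \<open>Nstar 0\<close>, so they sum to 1 without evaluating a series.\<close>
  have total: "(\<integral>\<^sup>+n. ennreal (gap_prob n) \<partial>count_space UNIV) = 1"
  proof -
    have "(\<Union>n. {\<eta>\<in>space (mu_star \<rho>). Nstar 0 \<eta> = n}) = space (mu_star \<rho>)"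
      by auto
    then have "1 = emeasure (mu_star \<rho>) (\<Union>n. {\<eta>\<in>space (mu_star \<rho>). Nstar 0 \<eta> = n})"
      using star.emeasure_space_1 by (simp only:)
    also have "\<dots> = (\<integral>\<^sup>+n. emeasure (mu_star \<rho>) {\<eta>\<in>space (mu_star \<rho>). Nstar 0 \<eta> = n} \<partial>count_space UNIV)"
      using meas by (intro emeasure_UN_countable) (auto simp: disjoint_family_on_def)
    also have "\<dots> = (\<integral>\<^sup>+n. ennreal (gap_prob n) \<partial>count_space UNIV)"
    proof (rule nn_integral_cong)
      fix n
      have "{0..<1 :: int} = {0}" by auto
      then show "emeasure (mu_star \<rho>) {\<eta>\<in>space (mu_star \<rho>). Nstar 0 \<eta> = n} = ennreal (gap_prob n)"
        using window[of 0 1 "\<lambda>_. n"] by (simp add: star.emeasure_eq_measure)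
    qed
    finally show ?thesis ..
  qed
  have joint: "measure (mu_star \<rho>) {\<eta> \<in> space (mu_star \<rho>). \<forall>i\<in>J. Nstar i \<eta> = x i} =
      (\<Prod>i\<in>J. gap_prob (x i))" if J: "finite J" for J x
  proof -
    \<comment> \<open>A symmetric window contains \<open>J\<close> and 0; the indices outside
      \<open>J\<close> are summed out.\<close>
    obtain B where B: "\<And>i. i \<in> J \<Longrightarrow> \<bar>i\<bar> \<le> B" "0 \<le> B"
    proof
      show "\<bar>i\<bar> \<le> (\<Sum>i\<in>J. \<bar>i\<bar>)" if "i \<in> J" for i
        using J that by (intro member_le_sum) auto
    qed (simp add: sum_nonneg)
    have "i \<in> {- B..<B + 1}" if "i \<in> J" for i
      using B(1)[OF that] by auto
    then have un: "J \<union> ({- B..<B + 1} - J) = {- B..<B + 1}"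
      by blast
    show ?thesis
    proof (rule star.joint_pmf_marginal[OF meas gap_prob_nonneg total _ J])
      show "measure (mu_star \<rho>) {\<eta> \<in> space (mu_star \<rho>).
          \<forall>i\<in>J \<union> ({- B..<B + 1} - J). Nstar i \<eta> = y i} =
          (\<Prod>i\<in>J \<union> ({- B..<B + 1} - J). gap_prob (y i))" for y
        unfolding un using B(2) by (intro window) auto
    qed auto
  qed
  have single: "measure (mu_star \<rho>) {\<eta> \<in> space (mu_star \<rho>). Nstar k \<eta> = n} = gap_prob n" for k n
    using joint[of "{k}" "\<lambda>_. n"] by simp
  have "distr (mu_star \<rho>) (count_space UNIV) (Nstar j) = distr (mu_star \<rho>) (count_space UNIV) (Nstar k)" for j k
  proof (rule measure_eqI_countable[where A = UNIV])
    fix n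
    show "emeasure (distr (mu_star \<rho>) (count_space UNIV) (Nstar j)) {n} =
        emeasure (distr (mu_star \<rho>) (count_space UNIV) (Nstar k)) {n}"
      using meas single[of j n] single[of k n]
      by (simp add: emeasure_distr star.emeasure_eq_measure vimage_def Int_def conj_commute)
  qed auto
  moreover have "gap_prob (3 * int n + 1) = dcoef n * \<rho> ^ (2 * n + 1) * (1 - \<rho>) ^ n" for n
  proof -
    have "nat (3 * int n + 1) = 3 * n + 1" by simp
    then show ?thesis
      unfolding gap_prob_def fp_prob_dcoef[symmetric] by simp
  qed
  ultimately show ?thesis
    using star.indep_vars_joint_pmf[OF meas joint] single by simp
qed

end
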